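(* For any tree $T$ of order $n$ (that is, with $n$ vertices), the game cordiality number of $T$ satisfies \[ c_g(T) \le \frac{1}{2}n . \]
   Context: The cordiality game is played on a finite graph $G=(V,E)$ by two players, Admirable and Impish, who alternately select a previously unlabeled vertex of $G$ until all vertices are labeled; Admirable makes the first move. Admirable labels each vertex he selects by $0$ and Impish labels each vertex he selects by $1$. When all vertices are labeled, each edge receives as label the sum modulo $2$ of the labels of its two endpoints. Let $e_0$ and $e_1$ be the numbers of edges labeled $0$ and $1$ respectively, and let the discrepancy be $d = |e_1 - e_0|$. Admirable attempts to minimize $d$ and Impish attempts to maximize $d$. The game cordiality number $c_g(G)$ is the value of $d$ when both players play optimally (i.e. the minimax value of this finite perfect-information game). *)

theory Defs
  imports Complex_Main
begin

section \<open>Finite simple graphs and trees\<close>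

definition simple_graph :: "'a set \<Rightarrow> 'a set set \<Rightarrow> bool" where
  "simple_graph V E \<longleftrightarrow> finite V \<and> (\<forall>e\<in>E. e \<subseteq> V \<and> card e = 2)"

definition adj :: "'a set set \<Rightarrow> 'a \<Rightarrow> 'a \<Rightarrow> bool" where
  "adj E u v \<longleftrightarrow> {u, v} \<in> E"

definition connected_graph :: "'a set \<Rightarrow> 'a set set \<Rightarrow> bool" where
  "connected_graph V E \<longleftrightarrow> V \<noteq> {} \<and> (\<forall>u\<in>V. \<forall>v\<in>V. (adj E)\<^sup>*\<^sup>* u v)"

text \<open>A cycle is the list of its distinct vertices; the closing edge joins the last one to the
  first. Without the bound on the length, every edge would count as a cycle.\<close>

definition is_cycle :: "'a set set \<Rightarrow> 'a list \<Rightarrow> bool" where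
  "is_cycle E c \<longleftrightarrow> length c \<ge> 3 \<and> distinct c \<and> successively (adj E) c \<and> adj E (last c) (hd c)"

definition tree :: "'a set \<Rightarrow> 'a set set \<Rightarrow> bool" where
  "tree V E \<longleftrightarrow> simple_graph V E \<and> connected_graph V E \<and> \<not> (\<exists>c. is_cycle E c)"

section \<open>The cordiality game\<close>

text \<open>A position is a partial labelling of the vertices, \<^term>\<open>None\<close> marking an unlabelled vertex.
  Edge labels are only meaningful once all vertices are labelled.\<close>

definition edge_label :: "('a \<rightharpoonup> nat) \<Rightarrow> 'a set \<Rightarrow> nat" where
  "edge_label f e = (\<Sum>v\<in>e. the (f v)) mod 2"

definition num_edges_labelled :: "'a set set \<Rightarrow> ('a \<rightharpoonup> nat) \<Rightarrow> nat \<Rightarrow> nat" where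
  "num_edges_labelled E f i = card {e \<in> E. edge_label f e = i}"

definition discrepancy :: "'a set set \<Rightarrow> ('a \<rightharpoonup> nat) \<Rightarrow> int" where
  "discrepancy E f = \<bar>int (num_edges_labelled E f 1) - int (num_edges_labelled E f 0)\<bar>"

datatype player = Admirable | Impish

text \<open>The minimax value of the position \<^term>\<open>f\<close> with the given player to move. The test for
  \<^prop>\<open>infinite V\<close> only serves to make the recursion terminate.\<close>

function game_value :: "'a set \<Rightarrow> 'a set set \<Rightarrow> player \<Rightarrow> ('a \<rightharpoonup> nat) \<Rightarrow> int" where
  "game_value V E p f =
    (if infinite V \<or> V \<subseteq> dom f then discrepancy E f
     else case p of
       Admirable \<Rightarrow> Min ((\<lambda>v. game_value V E Impish (f(v \<mapsto> 0))) ` (V - dom f))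
     | Impish \<Rightarrow> Max ((\<lambda>v. game_value V E Admirable (f(v \<mapsto> 1))) ` (V - dom f)))"
  by auto
termination
  by (relation "measure (\<lambda>(V, E, p, f). card (V - dom f))") (auto simp: card_gt_0_iff intro!: diff_less)

declare game_value.simps [simp del]

definition game_cordiality_number :: "'a set \<Rightarrow> 'a set set \<Rightarrow> int" where
  "game_cordiality_number V E = game_value V E Admirable Map.empty"

end

theory Submission
  imports Defs
begin

text \<open>With signs \<open>1\<close> and \<open>-1\<close> for the labels 0 and 1, the discrepancy is the absolute value of the
  sum of \<open>s u * s v\<close> over all edges \<open>{u, v}\<close>. Given any pairing of the vertices, Admirable can
  force the two vertices of each pair to get opposite signs by answering inside the pair; whenever
  he has to open a pair himself, its other vertex stays reserved for Impish. If
  the paired vertices \<open>a\<close> and \<open>b\<close> have a common neighbour \<open>w\<close>, then the edges \<open>{a, w}\<close> and \<open>{w, b}\<close>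
  cancel. So it suffices to find disjoint pairs of this kind, using disjoint pairs of edges, that
  leave at most half as many edges as there are vertices. They are found bottom-up in the rooted
  tree: a root keeps at most one pending child, which itself has at most one pending child. Two
  children that are not yet paired are paired with each other, and a root whose pending path has
  grown to three vertices is paired with its pending grandchild.\<close>

section \<open>Rooted trees\<close>

text \<open>A rooted tree is built by hanging a finished rooted tree below the root. The root of the
  first part stays the root, so an induction meets one new child subtree at a time.\<close>

inductive rooted_tree :: "'a \<Rightarrow> 'a set \<Rightarrow> 'a set set \<Rightarrow> bool" where
  single: "rooted_tree r {r} {}"
| join: "rooted_tree r V E \<Longrightarrow> rooted_tree r' V' E' \<Longrightarrow> V \<inter> V' = {} \<Longrightarrow>
    rooted_tree r (V \<union> V') (insert {r, r'} (E \<union> E'))"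

lemma rooted_tree_root: "rooted_tree r V E \<Longrightarrow> r \<in> V"
  by (induction rule: rooted_tree.induct) auto

lemma rooted_tree_finite: "rooted_tree r V E \<Longrightarrow> finite V"
  by (induction rule: rooted_tree.induct) auto

text \<open>Excluding the empty set makes edge sets over disjoint vertex sets disjoint, which
  \<open>reducible_join\<close> uses to split the edge sum.\<close>

lemma rooted_tree_edges: "rooted_tree r V E \<Longrightarrow> E \<subseteq> Pow V - {{}}"
proof (induction rule: rooted_tree.induct)
  case (join r V E r' V' E')
  then show ?case
    using rooted_tree_root[OF join.hyps(1)] rooted_tree_root[OF join.hyps(2)] by auto
qed auto

lemma rooted_tree_finite_edges: "rooted_tree r V E \<Longrightarrow> finite E"
  by (induction rule: rooted_tree.induct) auto

text \<open>Since \<open>join\<close> attaches only at the root, the new leaf is passed down to the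
  part that contains \<open>u\<close>.\<close>

lemma rooted_tree_add_leaf:
  assumes "rooted_tree r V E" "u \<in> V" "v \<notin> V"
  shows "rooted_tree r (insert v V) (insert {u, v} E)"
  using assms
proof (induction rule: rooted_tree.induct)
  case (single r)
  then show ?case
    using rooted_tree.join[OF rooted_tree.single[of r] rooted_tree.single[of v]]
    by (auto simp: insert_commute)
next
  case (join r V E r' V' E')
  show ?case
  proof (cases "u \<in> V")
    case True
    then have "rooted_tree r (insert v V \<union> V') (insert {r, r'} (insert {u, v} E \<union> E'))"
      using join by (intro rooted_tree.join) auto
    then show ?thesis by (simp add: insert_commute)
  next
    case False
    then have "rooted_tree r (V \<union> insert v V') (insert {r, r'} (E \<union> insert {u, v} E'))"
      using join by (intro rooted_tree.join) auto
    then show ?thesis by (simp add: insert_commute)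
  qed
qed

section \<open>Paths, and trees as rooted trees\<close>

lemma adj_sym: "adj E u v \<Longrightarrow> adj E v u"
  by (simp add: adj_def insert_commute)

lemma adj_rtranclp_mono:
  assumes "(adj E)\<^sup>*\<^sup>* u v" "E \<subseteq> F"
  shows "(adj F)\<^sup>*\<^sup>* u v"
  using assms(1) by (rule rtranclp_mono[THEN predicate2D, rotated]) (use assms(2) in \<open>auto simp: adj_def\<close>)

lemma adj_rtranclp_sym: "(adj E)\<^sup>*\<^sup>* u v \<Longrightarrow> (adj E)\<^sup>*\<^sup>* v u"
  by (metis adj_sym sympI sympD symp_rtranclp)

lemma rooted_tree_reachable:
  assumes "rooted_tree r V E" "v \<in> V"
  shows "(adj E)\<^sup>*\<^sup>* r v"
  using assms
proof (induction rule: rooted_tree.induct)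
  case (join r V E r' V' E')
  let ?E = "insert {r, r'} (E \<union> E')"
  show ?case
  proof (cases "v \<in> V")
    case True
    then show ?thesis using join.IH(1) by (auto intro: adj_rtranclp_mono)
  next
    case False
    then have "(adj ?E)\<^sup>*\<^sup>* r' v" using join by (auto intro: adj_rtranclp_mono)
    moreover have "adj ?E r r'" by (simp add: adj_def)
    ultimately show ?thesis by (rule converse_rtranclp_into_rtranclp[rotated])
  qed
qed auto

text \<open>Prepend \<open>u\<close> to the path from its successor; if \<open>u\<close> already
  lies on that path, keep only the suffix starting there.\<close>

lemma rtranclp_imp_distinct_path:
  assumes "R\<^sup>*\<^sup>* u v"
  shows "\<exists>p. p \<noteq> [] \<and> hd p = u \<and> last p = v \<and> distinct p \<and> successively R p"
  using assms
proof (induction rule: converse_rtranclp_induct)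
  case base
  show ?case by (rule exI[of _ "[v]"]) auto
next
  case (step u w)
  then obtain p where p: "p \<noteq> []" "hd p = w" "last p = v" "distinct p" "successively R p"
    by blast
  show ?case
  proof (cases "u \<in> set p")
    case True
    then obtain xs ys where "p = xs @ u # ys" by (meson split_list)
    then show ?thesis
      using p by (intro exI[of _ "u # ys"]) (auto simp: successively_append_iff)
  next
    case False
    then show ?thesis
      using p step.hyps by (intro exI[of _ "u # p"]) (auto simp: successively_Cons)
  qed
qed

lemma rtranclp_leaves_set:
  assumes "R\<^sup>*\<^sup>* u v" "u \<in> S" "v \<notin> S"
  obtains a b where "a \<in> S" "b \<notin> S" "R a b"
  using assms by (induction rule: rtranclp_induct) blast+

text \<open>A rooted subtree with the most vertices spans: otherwise connectivity gives an edge
  leaving it, whose far end could be added as a leaf. It also has every edge, since a missing one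
  would close a cycle with the path between its ends.\<close>

lemma tree_imp_rooted_tree:
  assumes "tree V E"
  obtains r where "rooted_tree r V E"
proof -
  have fin: "finite V" and edges: "\<And>e. e \<in> E \<Longrightarrow> e \<subseteq> V \<and> card e = 2"
    and conn: "\<And>u v. u \<in> V \<Longrightarrow> v \<in> V \<Longrightarrow> (adj E)\<^sup>*\<^sup>* u v" and "V \<noteq> {}"
    and acyclic: "\<And>c. \<not> is_cycle E c"
    using assms by (auto simp: tree_def simple_graph_def connected_graph_def)
  from \<open>V \<noteq> {}\<close> obtain r where r: "r \<in> V" by blast
  define P where "P S \<longleftrightarrow> S \<subseteq> V \<and> (\<exists>F\<subseteq>E. rooted_tree r S F)" for S
  have "P {r}"
    using r rooted_tree.single[of r] by (auto simp: P_def)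
  moreover have "\<forall>S. P S \<longrightarrow> card S < Suc (card V)"
    using fin by (auto simp: P_def less_Suc_eq_le intro: card_mono)
  ultimately obtain S where S: "P S" "\<And>S'. P S' \<Longrightarrow> card S' \<le> card S"
    using ex_has_greatest_nat[of P "{r}" card] by blast
  from S(1) obtain F where F: "S \<subseteq> V" "F \<subseteq> E" "rooted_tree r S F"
    by (auto simp: P_def)
  note rS = rooted_tree_root[OF F(3)]
  have "V \<subseteq> S"
  proof
    fix v assume "v \<in> V"
    show "v \<in> S"
    proof (rule ccontr)
      assume "v \<notin> S"
      then obtain a b where ab: "a \<in> S" "b \<notin> S" "adj E a b"
        using rtranclp_leaves_set[OF conn[OF r \<open>v \<in> V\<close>] rS] by blast
      then have "b \<in> V" using edges[of "{a, b}"] by (auto simp: adj_def)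
      then have "P (insert b S)"
        using ab F rooted_tree_add_leaf[OF F(3) ab(1,2)]
        by (auto simp: P_def adj_def intro!: exI[of _ "insert {a, b} F"])
      then have "card (insert b S) \<le> card S" by (rule S(2))
      then show False using ab(2) F(1) fin by (simp add: finite_subset)
    qed
  qed
  with F(1) have "S = V" by blast
  have "E \<subseteq> F"
  proof
    fix e assume e: "e \<in> E"
    show "e \<in> F"
    proof (rule ccontr)
      assume "e \<notin> F"
      obtain a b where ab: "e = {a, b}" "a \<noteq> b"
        using edges[OF e] by (meson card_2_iff)
      have "a \<in> S" "b \<in> S" using edges[OF e] ab \<open>S = V\<close> by auto
      then have "(adj F)\<^sup>*\<^sup>* a b"
        using rooted_tree_reachable[OF F(3)] adj_rtranclp_sym by (metis rtranclp_trans)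
      then obtain p where p: "p \<noteq> []" "hd p = a" "last p = b" "distinct p" "successively (adj F) p"
        by (auto dest: rtranclp_imp_distinct_path)
      \<comment> \<open>A path with one vertex would give \<open>a = b\<close>, and one with two
        vertices would put \<open>e\<close> into \<open>F\<close>.\<close>
      have "length p \<ge> 3"
      proof (rule ccontr)
        assume "\<not> length p \<ge> 3"
        then have "length p = 1 \<or> length p = 2" 
          using length_greater_0_conv[THEN iffD2, OF p(1)] by linarith
        then show False
          using p ab \<open>e \<notin> F\<close> by (auto simp: length_Suc_conv numeral_2_eq_2 adj_def)
      qed
      moreover have "successively (adj E) p"
        by (rule successively_mono[OF p(5)]) (use F(2) in \<open>auto simp: adj_def\<close>)
      moreover have "adj E (last p) (hd p)"
        using e ab p by (simp add: adj_def insert_commute)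
      ultimately have "is_cycle E p" using p by (simp add: is_cycle_def)
      then show False using acyclic by blast
    qed
  qed
  with F(2) have "F = E" by blast
  with F(3) \<open>S = V\<close> show thesis using that by blast
qed

section \<open>Pairings that cancel edges\<close>

text \<open>The pairs need not be edges of the graph, and they may leave vertices of
  \<open>U\<close> uncovered.\<close>

definition pairing :: "'a set \<Rightarrow> 'a set set \<Rightarrow> bool" where
  "pairing U M \<longleftrightarrow> \<Union>M \<subseteq> U \<and> pairwise disjnt M \<and> (\<forall>e\<in>M. card e = 2)"

definition signing :: "'a set set \<Rightarrow> ('a \<Rightarrow> int) \<Rightarrow> bool" where
  "signing M s \<longleftrightarrow> (\<forall>v. s v \<in> {1, -1}) \<and> (\<forall>e\<in>M. prod s e = -1)"

definition edge_sum :: "'a set set \<Rightarrow> ('a \<Rightarrow> int) \<Rightarrow> int" where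
  "edge_sum E s = (\<Sum>e\<in>E. prod s e)"

text \<open>The vertices in \<open>F\<close> are still to be paired, and \<open>q\<close> is the contribution of the edges among
  them that may still be cancelled.\<close>

definition reducible :: "'a set \<Rightarrow> 'a set set \<Rightarrow> 'a set \<Rightarrow> (('a \<Rightarrow> int) \<Rightarrow> int) \<Rightarrow> bool" where
  "reducible V E F q \<longleftrightarrow> F \<subseteq> V \<and> (\<exists>M. pairing (V - F) M \<and>
     (\<forall>s. signing M s \<longrightarrow> 2 * \<bar>edge_sum E s - q s\<bar> \<le> int (card V) - int (card F)))"

lemma abs_diff_bound_trans:
  fixes a b c k l m :: int
  shows "2 * \<bar>a - b\<bar> \<le> m - k \<Longrightarrow> 2 * \<bar>b - c\<bar> \<le> k - l \<Longrightarrow> 2 * \<bar>a - c\<bar> \<le> m - l"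
  by arith

lemma abs_diff_bound_add:
  fixes a b c d k l m n :: int
  shows "2 * \<bar>a - b\<bar> \<le> m - k \<Longrightarrow> 2 * \<bar>c - d\<bar> \<le> n - l \<Longrightarrow>
    2 * \<bar>a + c - (b + d)\<bar> \<le> m + n - (k + l)"
  by arith

lemma signing_subset: "signing M s \<Longrightarrow> N \<subseteq> M \<Longrightarrow> signing N s"
  by (auto simp: signing_def)

lemma pairing_elem:
  assumes "pairing U M" "e \<in> M"
  obtains a b where "e = {a, b}" "a \<noteq> b" "a \<in> U" "b \<in> U"
proof -
  have "card e = 2" "e \<subseteq> U" using assms unfolding pairing_def by blast+
  then show thesis using that by (auto simp: card_2_iff)
qed

lemma pairing_union:
  assumes "pairing U M" "pairing U' M'" "U \<inter> U' = {}"
  shows "pairing (U \<union> U') (M \<union> M')"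
proof -
  have "disjnt e e'" if "e \<in> M" "e' \<in> M'" for e e'
    using that assms by (auto simp: pairing_def disjnt_def)
  then show ?thesis
    using assms by (auto simp: pairing_def pairwise_def disjnt_sym)
qed

lemma pairing_mono: "pairing U M \<Longrightarrow> U \<subseteq> U' \<Longrightarrow> pairing U' M"
  by (auto simp: pairing_def)

lemma pairing_insert:
  assumes "pairing U M" "a \<notin> U" "b \<notin> U" "a \<noteq> b"
  shows "pairing (insert a (insert b U)) (insert {a, b} M)"
proof -
  have "pairing ({a, b} \<union> U) ({{a, b}} \<union> M)"
    using assms by (intro pairing_union) (auto simp: pairing_def)
  then show ?thesis by simp
qed

text \<open>The edge sums of the two parts add up, and the term of the new edge goes to the pending
  contribution. So both the errors and the budgets simply add.\<close>

lemma reducible_join: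
  assumes "reducible V E F q" "reducible V' E' F' q'" "V \<inter> V' = {}"
    and T: "rooted_tree r V E" and T': "rooted_tree r' V' E'"
  shows "reducible (V \<union> V') (insert {r, r'} (E \<union> E')) (F \<union> F') (\<lambda>s. q s + q' s + s r * s r')"
proof -
  obtain M M' where M: "pairing (V - F) M" "pairing (V' - F') M'"
    and bound: "\<And>s. signing M s \<Longrightarrow> 2 * \<bar>edge_sum E s - q s\<bar> \<le> int (card V) - int (card F)"
    and bound': "\<And>s. signing M' s \<Longrightarrow> 2 * \<bar>edge_sum E' s - q' s\<bar> \<le> int (card V') - int (card F')"
    and sub: "F \<subseteq> V" "F' \<subseteq> V'"
    using assms(1,2) unfolding reducible_def by blast
  have fin: "finite V" "finite V'" "finite E" "finite E'"
    using T T' by (auto dest: rooted_tree_finite rooted_tree_finite_edges)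
  have r: "r \<in> V" "r' \<in> V'" using T T' by (auto dest: rooted_tree_root)
  have E: "E \<subseteq> Pow V - {{}}" "E' \<subseteq> Pow V' - {{}}" using rooted_tree_edges[OF T] rooted_tree_edges[OF T'] by auto
  have "E \<inter> E' = {}" using E assms(3) by blast
  moreover have "{r, r'} \<notin> E \<union> E'" using E r assms(3) by blast
  moreover have "r \<noteq> r'" using r assms(3) by blast
  ultimately have sum: "edge_sum (insert {r, r'} (E \<union> E')) s = edge_sum E s + edge_sum E' s + s r * s r'"
    for s using fin by (simp add: edge_sum_def sum.union_disjoint)
  have card: "card (V \<union> V') = card V + card V'" "card (F \<union> F') = card F + card F'"
    using fin sub assms(3) by (auto intro!: card_Un_disjoint dest: finite_subset)
  have "V \<union> V' - (F \<union> F') = (V - F) \<union> (V' - F')"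
    using sub assms(3) by blast
  moreover have "pairing ((V - F) \<union> (V' - F')) (M \<union> M')"
    using M assms(3) by (intro pairing_union) auto
  ultimately have "pairing (V \<union> V' - (F \<union> F')) (M \<union> M')" by simp
  moreover have "2 * \<bar>edge_sum (insert {r, r'} (E \<union> E')) s - (q s + q' s + s r * s r')\<bar>
      \<le> int (card (V \<union> V')) - int (card (F \<union> F'))" if "signing (M \<union> M') s" for s
  proof -
    have "signing M s" "signing M' s" using that by (auto intro: signing_subset)
    from abs_diff_bound_add[OF bound[OF this(1)] bound'[OF this(2)]]
    show ?thesis by (simp add: sum card)
  qed
  ultimately show ?thesis using sub unfolding reducible_def by blast
qed

text \<open>Each vertex that leaves \<open>F\<close> adds 1 to the budget for twice the error. The
  last hypothesis says that this pays for replacing \<open>q\<close> by \<open>q'\<close>; the rest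
  is the triangle inequality.\<close>

lemma reducible_relax:
  assumes "reducible V E F q" "F' \<subseteq> F"
    and "\<And>s. (\<And>v. s v \<in> {1, -1}) \<Longrightarrow> 2 * \<bar>q s - q' s\<bar> \<le> int (card F) - int (card F')"
  shows "reducible V E F' q'"
proof -
  obtain M where M: "pairing (V - F) M" "F \<subseteq> V"
    and bound: "\<And>s. signing M s \<Longrightarrow> 2 * \<bar>edge_sum E s - q s\<bar> \<le> int (card V) - int (card F)"
    using assms(1) unfolding reducible_def by blast
  have "2 * \<bar>edge_sum E s - q' s\<bar> \<le> int (card V) - int (card F')" if "signing M s" for s
  proof -
    have "2 * \<bar>q s - q' s\<bar> \<le> int (card F) - int (card F')"
      using that by (intro assms(3)) (auto simp: signing_def)
    with bound[OF that] show ?thesis by (rule abs_diff_bound_trans)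
  qed
  then show ?thesis
    using M assms(2) pairing_mono[OF M(1), of "V - F'"] unfolding reducible_def by blast
qed

text \<open>As in \<open>reducible_relax\<close>, but \<open>a\<close> and \<open>b\<close> leave
  \<open>F\<close> as a new pair, so \<open>q\<close> and \<open>q'\<close> are compared only for
  \<open>s a = - s b\<close>.\<close>

lemma reducible_pair:
  assumes "reducible V E F q" "F' \<subseteq> F - {a, b}" "a \<in> F" "b \<in> F" "a \<noteq> b"
    and "\<And>s. (\<And>v. s v \<in> {1, -1}) \<Longrightarrow> s a = - s b \<Longrightarrow>
      2 * \<bar>q s - q' s\<bar> \<le> int (card F) - int (card F')"
  shows "reducible V E F' q'"
proof -
  obtain M where M: "pairing (V - F) M" "F \<subseteq> V"
    and bound: "\<And>s. signing M s \<Longrightarrow> 2 * \<bar>edge_sum E s - q s\<bar> \<le> int (card V) - int (card F)"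
    using assms(1) unfolding reducible_def by blast
  have "2 * \<bar>edge_sum E s - q' s\<bar> \<le> int (card V) - int (card F')"
    if s: "signing (insert {a, b} M) s" for s
  proof -
    have 1: "s v \<in> {1, -1}" for v using s by (auto simp: signing_def)
    have "s a * s b = -1" using s assms(5) by (simp add: signing_def)
    then have "s a = - s b" using 1[of a] 1[of b] by auto
    with 1 have 2: "2 * \<bar>q s - q' s\<bar> \<le> int (card F) - int (card F')" by (intro assms(6))
    have "signing M s" using s by (auto intro: signing_subset)
    from bound[OF this] 2 show ?thesis by (rule abs_diff_bound_trans)
  qed
  moreover have "pairing (V - F') (insert {a, b} M)"
    using assms(2-5) M
    by (intro pairing_mono[OF pairing_insert[OF M(1)]]) auto
  ultimately show ?thesis
    using M assms(2) unfolding reducible_def by blast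
qed

text \<open>The disjuncts are the states of a root: nothing pending below it, a pending child
  \<open>c\<close>, or a pending child \<open>c\<close> with a pending child \<open>d\<close> of its
  own. A new child in the third state is absorbed. Any other new child becomes pending if
  \<open>r\<close> has no pending child; otherwise it is paired with \<open>c\<close>, which returns
  \<open>r\<close> to the first state.\<close>

lemma rooted_tree_reducible:
  assumes "rooted_tree r V E"
  shows "reducible V E {r} (\<lambda>s. 0)
    \<or> (\<exists>c. distinct [r, c] \<and> reducible V E {r, c} (\<lambda>s. s r * s c))
    \<or> (\<exists>c d. distinct [r, c, d] \<and> reducible V E {r, c, d} (\<lambda>s. s r * s c + s c * s d))"
  using assms
proof (induction rule: rooted_tree.induct)
  case (single r)
  have "reducible {r} {} {r} (\<lambda>s. 0)"
    by (auto simp: reducible_def pairing_def edge_sum_def intro!: exI[of _ "{}"])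
  then show ?case by blast
next
  case (join r V E r' V' E')
  let ?W = "V \<union> V'" and ?E = "insert {r, r'} (E \<union> E')"
  have J: "reducible ?W ?E (F \<union> F') (\<lambda>s. q s + q' s + s r * s r')"
    if "reducible V E F q" "reducible V' E' F' q'" for F q F' q'
    using that join.hyps by (intro reducible_join)
  have sub: "F \<subseteq> V" if "reducible V E F q" for F q using that by (simp add: reducible_def)
  have sub': "F \<subseteq> V'" if "reducible V' E' F q" for F q using that by (simp add: reducible_def)
  \<comment> \<open>Pairing \<open>r'\<close> with its grandchild \<open>d\<close> cancels the two
    terms through \<open>c\<close>. The new edge costs 2, three vertices leave the pending set, and
    the state of \<open>r\<close> does not change.\<close>
  have absorb: "reducible ?W ?E F q"
    if X: "reducible V E F q" and Y: "reducible V' E' {r', c, d} (\<lambda>s. s r' * s c + s c * s d)"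
      and d: "distinct [r', c, d]" for F q c d
  proof (rule reducible_pair[OF J[OF X Y], of _ r' d])
    have disj: "F \<inter> {r', c, d} = {}" using sub[OF X] sub'[OF Y] join.hyps(3) by blast
    show "F \<subseteq> F \<union> {r', c, d} - {r', d}" using disj by blast
    have "finite F"
      using sub[OF X] rooted_tree_finite[OF join.hyps(1)] by (rule finite_subset)
    then have "card (F \<union> {r', c, d}) = card F + 3"
      using disj d by (subst card_Un_disjoint) auto
    then show "2 * \<bar>q s + (s r' * s c + s c * s d) + s r * s r' - q s\<bar>
        \<le> int (card (F \<union> {r', c, d})) - int (card F)"
      if s: "\<And>v. s v \<in> {1, - 1}" "s r' = - s d" for s :: "'a \<Rightarrow> int"
      using s(1)[of r] s(1)[of c] s(1)[of d] s(2) by auto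
  qed (use d in auto)
  have bounds: "s x * s y \<in> {1, -1}" if "\<And>v. s v \<in> {1, - 1}" for s :: "'a \<Rightarrow> int" and x y
    using that[of x] that[of y] by auto
  consider (C') c' d' where "distinct [r', c', d']"
      "reducible V' E' {r', c', d'} (\<lambda>s. s r' * s c' + s c' * s d')"
    | (A') "reducible V' E' {r'} (\<lambda>s. 0)"
    | (B') c' where "distinct [r', c']" "reducible V' E' {r', c'} (\<lambda>s. s r' * s c')"
    using join.IH(2) by blast
  then show ?case
  proof cases
    case C'
    from join.IH(1) show ?thesis using absorb[OF _ C'(2,1)] by blast
  next
    case A'
    have r': "r' \<notin> V" using sub'[OF A'] join.hyps(3) by blast
    consider (A) "reducible V E {r} (\<lambda>s. 0)"
      | (B) c where "distinct [r, c]" "reducible V E {r, c} (\<lambda>s. s r * s c)"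
      | (C) c d where "distinct [r, c, d]" "reducible V E {r, c, d} (\<lambda>s. s r * s c + s c * s d)"
      using join.IH(1) by blast
    then show ?thesis
    proof cases
      case A
      have "reducible ?W ?E {r, r'} (\<lambda>s. s r * s r')"
        using J[OF A A'] by (simp add: insert_commute)
      moreover have "r \<noteq> r'" using sub[OF A] r' by auto
      ultimately show ?thesis by auto
    next
      case B
      have d: "r \<noteq> r'" "c \<noteq> r'" using sub[OF B(2)] r' by auto
      \<comment> \<open>The terms of the siblings \<open>c\<close> and \<open>r'\<close> at
        \<open>r\<close> cancel, and nothing is left over.\<close>
      have "reducible ?W ?E {r} (\<lambda>s. 0)"
        by (rule reducible_pair[OF J[OF B(2) A'], of _ c r']) (use B d in auto)
      then show ?thesis by blast
    next
      case C
      have d: "r \<noteq> r'" "c \<noteq> r'" "d \<noteq> r'" using sub[OF C(2)] r' by auto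
      \<comment> \<open>After the cancellation at \<open>r\<close> the term \<open>s c * s d\<close>
        is left. It costs 2, and three vertices leave the pending set.\<close>
      have "reducible ?W ?E {r} (\<lambda>s. 0)"
      proof (rule reducible_pair[OF J[OF C(2) A'], of _ c r'])
        fix s :: "'a \<Rightarrow> int" assume s: "\<And>v. s v \<in> {1, - 1}" "s c = - s r'"
        show "2 * \<bar>s r * s c + s c * s d + 0 + s r * s r' - 0\<bar>
            \<le> int (card ({r, c, d} \<union> {r'})) - int (card {r})"
          using bounds[of s r' d, OF s(1)] s(2) C(1) d by auto
      qed (use C d in auto)
      then show ?thesis by blast
    qed
  next
    case B'
    have r': "r' \<notin> V" "c' \<notin> V" using sub'[OF B'(2)] join.hyps(3) by blast+
    consider (A) "reducible V E {r} (\<lambda>s. 0)"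
      | (B) c where "distinct [r, c]" "reducible V E {r, c} (\<lambda>s. s r * s c)"
      | (C) c d where "distinct [r, c, d]" "reducible V E {r, c, d} (\<lambda>s. s r * s c + s c * s d)"
      using join.IH(1) by blast
    then show ?thesis
    proof cases
      case A
      have "reducible ?W ?E {r, r', c'} (\<lambda>s. s r * s r' + s r' * s c')"
        using J[OF A B'(2)] by (simp add: add.commute insert_commute)
      moreover have "r \<noteq> r'" "r \<noteq> c'" using sub[OF A] r' by auto
      ultimately show ?thesis using B'(1) by auto
    next
      case B
      have d: "r \<noteq> r'" "c \<noteq> r'" "r \<noteq> c'" "c \<noteq> c'" using sub[OF B(2)] r' by auto
      \<comment> \<open>The term \<open>s r' * s c'\<close> is left, again at cost 2 against three
        vertices.\<close>
      have "reducible ?W ?E {r} (\<lambda>s. 0)"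
      proof (rule reducible_pair[OF J[OF B(2) B'(2)], of _ c r'])
        fix s :: "'a \<Rightarrow> int" assume s: "\<And>v. s v \<in> {1, - 1}" "s c = - s r'"
        show "2 * \<bar>s r * s c + s r' * s c' + s r * s r' - 0\<bar>
            \<le> int (card ({r, c} \<union> {r', c'})) - int (card {r})"
          using bounds[of s r' c', OF s(1)] s(2) B(1) B'(1) d by auto
      qed (use B d in auto)
      then show ?thesis by blast
    next
      case C
      have d: "r \<noteq> r'" "c \<noteq> r'" "d \<noteq> r'" "r \<noteq> c'" "c \<noteq> c'" "d \<noteq> c'"
        using sub[OF C(2)] r' by auto
      \<comment> \<open>The tight case: both \<open>s c * s d\<close> and \<open>s r' * s c'\<close>
        are left, costing up to 4, and exactly four vertices leave the pending set.\<close>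
      have "reducible ?W ?E {r} (\<lambda>s. 0)"
      proof (rule reducible_pair[OF J[OF C(2) B'(2)], of _ c r'])
        fix s :: "'a \<Rightarrow> int" assume s: "\<And>v. s v \<in> {1, - 1}" "s c = - s r'"
        show "2 * \<bar>s r * s c + s c * s d + s r' * s c' + s r * s r' - 0\<bar>
            \<le> int (card ({r, c, d} \<union> {r', c'})) - int (card {r})"
          using bounds[of s r' d, OF s(1)] bounds[of s r' c', OF s(1)] s(2) C(1) B'(1) d by auto
      qed (use C d in auto)
      then show ?thesis by blast
    qed
  qed
qed

lemma rooted_tree_pairing:
  assumes "rooted_tree r V E"
  obtains M where "pairing V M" "\<And>s. signing M s \<Longrightarrow> 2 * \<bar>edge_sum E s\<bar> \<le> int (card V)"
proof -
  from rooted_tree_reducible[OF assms] have "reducible V E {} (\<lambda>s. 0)"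
  proof (elim disjE exE conjE)
    assume "reducible V E {r} (\<lambda>s. 0)"
    then show ?thesis by (rule reducible_relax) auto
  next
    \<comment> \<open>Here \<open>r\<close> and \<open>c\<close> stay unpaired: their term costs 2,
      which the two vertices just pay for.\<close>
    fix c assume "distinct [r, c]" "reducible V E {r, c} (\<lambda>s. s r * s c)"
    then show ?thesis
    proof (elim reducible_relax)
      fix s :: "'a \<Rightarrow> int" assume "\<And>v. s v \<in> {1, - 1}"
      from this[of r] this[of c] \<open>distinct [r, c]\<close>
      show "2 * \<bar>s r * s c - 0\<bar> \<le> int (card {r, c}) - int (card {})" by auto
    qed auto
  next
    \<comment> \<open>Pairing \<open>r\<close> with \<open>d\<close> cancels both pending
      terms.\<close>
    fix c d assume "distinct [r, c, d]" "reducible V E {r, c, d} (\<lambda>s. s r * s c + s c * s d)"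
    then show ?thesis by (elim reducible_pair[where a = r and b = d]) auto
  qed
  then show thesis using that by (auto simp: reducible_def)
qed

text \<open>The strategy tolerates only one uncovered vertex. Extra pairs do no harm, since a
  labelling that splits the pairs of \<open>N\<close> also splits those of \<open>M\<close>.\<close>

lemma pairing_extend:
  assumes "finite V" "pairing V M"
  obtains N where "M \<subseteq> N" "pairing V N" "card (V - \<Union>N) \<le> 1"
proof -
  have "\<exists>N. M \<subseteq> N \<and> pairing V N \<and> card (V - \<Union>N) \<le> 1"
    using assms(2)
  proof (induction "card (V - \<Union>M)" arbitrary: M rule: less_induct)
    case less
    show ?case
    proof (cases "card (V - \<Union>M) \<le> 1")
      case False
      then obtain a b where ab: "a \<in> V - \<Union>M" "b \<in> V - \<Union>M" "a \<noteq> b"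
        using card_le_Suc0_iff_eq[of "V - \<Union>M"] assms(1) by auto
      have "pairing (\<Union>M) M" using less.prems by (auto simp: pairing_def)
      then have "pairing V (insert {a, b} M)"
        using ab less.prems
        by (intro pairing_mono[OF pairing_insert]) (auto simp: pairing_def)
      moreover have "card (V - \<Union>(insert {a, b} M)) < card (V - \<Union>M)"
        using ab assms(1) by (intro psubset_card_mono) auto
      ultimately show ?thesis using less.hyps by blast
    qed (use less.prems in blast)
  qed
  then show thesis using that by blast
qed

section \<open>The pairing strategy\<close>

definition splits_pairs :: "'a set \<Rightarrow> 'a set set \<Rightarrow> ('a \<rightharpoonup> nat) \<Rightarrow> bool" where
  "splits_pairs V M g \<longleftrightarrow> (\<forall>v\<in>V. g v \<in> {Some 0, Some 1}) \<and> (\<forall>e\<in>M. g ` e = {Some 0, Some 1})"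

lemma card_le_1_singleton:
  assumes "finite A" "card A \<le> 1" "x \<in> A"
  shows "A = {x}"
  using assms card_le_Suc0_iff_eq[OF assms(1)] by auto

text \<open>Undoes one round of play: \<open>X\<close> holds the vertices just labelled,
  \<open>e\<close> is the pair taken out of the pairing. They differ when Admirable opens a pair and
  leaves its other vertex to Impish.\<close>

lemma splits_pairs_extend:
  assumes "splits_pairs (V - X) (M - {e}) g" "g ` e = {Some 0, Some 1}"
    and "\<And>x. x \<in> X \<Longrightarrow> g x \<in> {Some 0, Some 1}"
  shows "splits_pairs V M g"
  using assms unfolding splits_pairs_def by (metis Diff_iff singletonD)

lemma game_value_finished: "V \<subseteq> dom f \<Longrightarrow> game_value V E p f = discrepancy E f"
  by (subst game_value.simps) simp

lemma game_value_Admirable_le: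
  assumes "finite V" "v \<in> V - dom f"
  shows "game_value V E Admirable f \<le> game_value V E Impish (f(v \<mapsto> 0))"
  using assms by (subst game_value.simps) (auto intro!: Min_le)

lemma game_value_Impish_le:
  assumes "finite V" "\<not> V \<subseteq> dom f"
    and "\<And>v. v \<in> V - dom f \<Longrightarrow> game_value V E Admirable (f(v \<mapsto> 1)) \<le> k"
  shows "game_value V E Impish f \<le> k"
  using assms by (subst game_value.simps) (auto intro!: Max.boundedI)

lemma pairing_remove:
  assumes "pairing U M" "{a, b} \<in> M"
  shows "pairing (U - {a, b}) (M - {{a, b}})" "\<Union>(M - {{a, b}}) = \<Union>M - {a, b}" "a \<noteq> b"
proof -
  have "e \<inter> {a, b} = {}" if "e \<in> M" "e \<noteq> {a, b}" for e
    using pairwiseD[of disjnt M e "{a, b}"] assms that by (simp add: pairing_def disjnt_def)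
  then show *: "\<Union>(M - {{a, b}}) = \<Union>M - {a, b}" by blast
  show "pairing (U - {a, b}) (M - {{a, b}})"
    using assms unfolding pairing_def * by (blast intro: pairwise_subset)
  show "a \<noteq> b" using assms by (auto simp: pairing_def)
qed

text \<open>With Impish to move, an unpaired vertex is reserved for her: it ends up with label 1.\<close>

lemma game_value_Impish_pairing:
  assumes "finite V" "pairing (V - dom f) M" "card (V - dom f - \<Union>M) \<le> 1"
    and "\<And>g. f \<subseteq>\<^sub>m g \<Longrightarrow> splits_pairs (V - dom f) M g \<Longrightarrow>
      (\<And>v. v \<in> V - dom f - \<Union>M \<Longrightarrow> g v = Some 1) \<Longrightarrow> discrepancy E g \<le> k"
  shows "game_value V E Impish f \<le> k"
  using assms(2-)
proof (induction "card (V - dom f)" arbitrary: f M rule: less_induct)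
  case less
  let ?U = "V - dom f"
  show ?case
  proof (cases "V \<subseteq> dom f")
    case True
    then have U: "?U = {}" by blast
    have "M = {}"
    proof (rule ccontr)
      assume "M \<noteq> {}"
      then obtain e where "e \<in> M" by blast
      then have "e = {}" "card e = 2" using U less.prems(1) unfolding pairing_def by blast+
      then show False by simp
    qed
    with U show ?thesis
      using True less.prems(3)[of f] unfolding U by (simp add: game_value_finished splits_pairs_def)
  next
    case False
    show ?thesis
    proof (rule game_value_Impish_le[OF assms(1) False])
      fix v assume v: "v \<in> ?U"
      show "game_value V E Admirable (f(v \<mapsto> 1)) \<le> k"
      proof (cases "v \<in> \<Union>M")
        case True
        then obtain e where e: "e \<in> M" "v \<in> e" by blast
        obtain a b where "e = {a, b}" using pairing_elem[OF less.prems(1) e(1)] .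
        with e obtain w where w: "{v, w} \<in> M" by (auto simp: insert_commute)
        note rem = pairing_remove[OF less.prems(1) w]
        \<comment> \<open>Impish has entered a pair, and Admirable answers with its other vertex
          \<open>w\<close>. The set of uncovered vertices stays the same.\<close>
        let ?f = "f(v \<mapsto> 1, w \<mapsto> 0)" and ?M = "M - {{v, w}}"
        have wU: "w \<in> ?U" using w less.prems(1) by (auto simp: pairing_def)
        have U: "V - dom ?f = ?U - {v, w}" by auto
        have rest: "?U - {v, w} - \<Union>?M = ?U - \<Union>M" using rem(2) w by auto
        have "game_value V E Impish ?f \<le> k"
        proof (rule less.hyps[of ?f ?M])
          show "card (V - dom ?f) < card ?U"
            unfolding U using v assms(1) by (intro psubset_card_mono) auto
          show "pairing (V - dom ?f) ?M" unfolding U by (rule rem(1))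
          show "card (V - dom ?f - \<Union>?M) \<le> 1" unfolding U rest by (rule less.prems(2))
          fix g assume g: "?f \<subseteq>\<^sub>m g" "splits_pairs (V - dom ?f) ?M g"
            "\<And>v. v \<in> V - dom ?f - \<Union>?M \<Longrightarrow> g v = Some 1"
          have gvw: "g v = Some 1" "g w = Some 0"
            using g(1) rem(3) by (auto simp: map_le_def dom_def split: if_splits)
          show "discrepancy E g \<le> k"
          proof (rule less.prems(3))
            show "f \<subseteq>\<^sub>m g"
              using g(1) v wU by (auto simp: map_le_def split: if_splits)
            show "splits_pairs ?U M g"
              using gvw by (intro splits_pairs_extend[OF g(2)[unfolded U]]) auto
            show "g x = Some 1" if "x \<in> ?U - \<Union>M" for x
              using g(3) that unfolding U rest by blast
          qed
        qed
        moreover have "game_value V E Admirable (f(v \<mapsto> 1)) \<le> game_value V E Impish ?f"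
          using assms(1) wU rem(3) by (intro game_value_Admirable_le) auto
        ultimately show ?thesis by simp
      next
        case False
        \<comment> \<open>Impish has taken the reserved vertex, so all other free vertices lie in
          pairs.\<close>
        then have cover: "?U - \<Union>M = {v}"
          using v less.prems(2) assms(1) by (intro card_le_1_singleton) auto
        show ?thesis
        proof (cases "M = {}")
          case True
          with cover have "?U = {v}" by simp
          then have "game_value V E Admirable (f(v \<mapsto> 1)) = discrepancy E (f(v \<mapsto> 1))"
            by (intro game_value_finished) auto
          also have "\<dots> \<le> k"
            using \<open>?U = {v}\<close> True v
            by (intro less.prems(3)) (auto simp: map_le_def splits_pairs_def)
          finally show ?thesis .
        next
          case notempty: False
          then obtain e where "e \<in> M" by blast
          moreover obtain a b where "e = {a, b}" using pairing_elem[OF less.prems(1) \<open>e \<in> M\<close>] .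
          ultimately have ab: "{a, b} \<in> M" by simp
          note rem = pairing_remove[OF less.prems(1) ab]
          \<comment> \<open>Admirable has to open a pair: he labels \<open>a\<close>, and
            \<open>b\<close> becomes the vertex reserved for Impish. The induction hypothesis then
            gives \<open>b\<close> the label 1.\<close>
          let ?f = "f(v \<mapsto> 1, a \<mapsto> 0)" and ?M = "M - {{a, b}}"
          have abU: "a \<in> ?U" "b \<in> ?U" using ab less.prems(1) by (auto simp: pairing_def)
          have v_ab: "v \<noteq> a" "v \<noteq> b" using False ab by auto
          have U: "V - dom ?f = ?U - {v, a}" by auto
          have "\<Union>M \<subseteq> ?U" using less.prems(1) by (simp add: pairing_def)
          then have rest: "?U - {v, a} - \<Union>?M = {b}"
            using rem(2,3) cover ab v_ab abU by auto
          have "game_value V E Impish ?f \<le> k"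
          proof (rule less.hyps[of ?f ?M])
            show "card (V - dom ?f) < card ?U"
              unfolding U using v assms(1) by (intro psubset_card_mono) auto
            show "pairing (V - dom ?f) ?M"
              using rem(1,2) False unfolding U pairing_def by auto
            show "card (V - dom ?f - \<Union>?M) \<le> 1" unfolding U rest by simp
            fix g assume g: "?f \<subseteq>\<^sub>m g" "splits_pairs (V - dom ?f) ?M g"
              "\<And>v. v \<in> V - dom ?f - \<Union>?M \<Longrightarrow> g v = Some 1"
            have gv: "g v = Some 1" "g a = Some 0"
              using g(1) v_ab by (auto simp: map_le_def dom_def split: if_splits)
            have gb: "g b = Some 1" using g(3) unfolding U rest by blast
            show "discrepancy E g \<le> k"
            proof (rule less.prems(3))
              show "f \<subseteq>\<^sub>m g"
                using g(1) v abU by (auto simp: map_le_def split: if_splits)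
              show "splits_pairs ?U M g"
                using gv gb by (intro splits_pairs_extend[OF g(2)[unfolded U]]) auto
              show "g x = Some 1" if "x \<in> ?U - \<Union>M" for x
                using that gv unfolding cover by blast
            qed
          qed
          moreover have "game_value V E Admirable (f(v \<mapsto> 1)) \<le> game_value V E Impish ?f"
            using assms(1) abU v_ab by (intro game_value_Admirable_le) auto
          ultimately show ?thesis by simp
        qed
      qed
    qed
  qed
qed

text \<open>The first move is chosen so that at most one free vertex is uncovered when Impish moves,
  as \<open>game_value_Impish_pairing\<close> requires.\<close>

lemma game_cordiality_number_pairing:
  assumes "finite V" "V \<noteq> {}" "pairing V M"
    and disc: "\<And>g. splits_pairs V M g \<Longrightarrow> discrepancy E g \<le> k"
  shows "game_cordiality_number V E \<le> k"
proof -
  obtain N where N: "M \<subseteq> N" "pairing V N" "card (V - \<Union>N) \<le> 1"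
    using pairing_extend[OF assms(1,3)] .
  have disc: "discrepancy E g \<le> k" if "splits_pairs V N g" for g
    using that N(1) by (intro disc) (unfold splits_pairs_def, blast)
  have start: "game_cordiality_number V E \<le> k"
    if "a \<in> V" "game_value V E Impish [a \<mapsto> 0] \<le> k" for a
    using game_value_Admirable_le[of V a Map.empty E] that assms(1)
    by (simp add: game_cordiality_number_def)
  have dom: "V - dom [a \<mapsto> 0 :: nat] = V - {a}" for a by simp
  show ?thesis
  proof (cases "V - \<Union>N = {}")
    case False
    \<comment> \<open>Admirable takes the uncovered vertex himself, so no vertex has to be
      reserved.\<close>
    then obtain a where a: "a \<in> V - \<Union>N" by blast
    then have cover: "V - \<Union>N = {a}"
      using N(3) assms(1) by (intro card_le_1_singleton) auto
    have "game_value V E Impish [a \<mapsto> 0] \<le> k"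
    proof (rule game_value_Impish_pairing[OF assms(1), of _ N]; unfold dom)
      show "pairing (V - {a}) N" using N(2) a by (auto simp: pairing_def)
      have "V - {a} - \<Union>N = {}" using cover by blast
      then show "card (V - {a} - \<Union>N) \<le> 1" by (simp only: card.empty)
      fix g assume "[a \<mapsto> 0] \<subseteq>\<^sub>m g" "splits_pairs (V - {a}) N g"
      then show "discrepancy E g \<le> k"
        by (intro disc) (auto simp: splits_pairs_def map_le_def)
    qed
    then show ?thesis using start a by blast
  next
    case True
    \<comment> \<open>Every vertex is paired, so Admirable opens a pair \<open>{a, b}\<close> and
      reserves \<open>b\<close> for Impish.\<close>
    then have "N \<noteq> {}" using assms(2) by auto
    then obtain a b where ab: "{a, b} \<in> N"
      using pairing_elem[OF N(2)] by (metis ex_in_conv)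
    note rem = pairing_remove[OF N(2) ab]
    have abV: "a \<in> V" "b \<in> V" using ab N(2) by (auto simp: pairing_def)
    have rest: "V - {a} - \<Union>(N - {{a, b}}) = {b}"
      using True rem(2,3) abV ab by auto
    have "game_value V E Impish [a \<mapsto> 0] \<le> k"
    proof (rule game_value_Impish_pairing[OF assms(1), of _ "N - {{a, b}}"]; unfold dom)
      show "pairing (V - {a}) (N - {{a, b}})"
        by (rule pairing_mono[OF rem(1)]) auto
      show "card (V - {a} - \<Union>(N - {{a, b}})) \<le> 1" unfolding rest by simp
      fix g assume g: "[a \<mapsto> 0] \<subseteq>\<^sub>m g" "splits_pairs (V - {a}) (N - {{a, b}}) g"
        "\<And>v. v \<in> V - {a} - \<Union>(N - {{a, b}}) \<Longrightarrow> g v = Some 1"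
      have "g b = Some 1" using g(3) unfolding rest by blast
      moreover have "g a = Some 0" using g(1) by (simp add: map_le_def)
      ultimately show "discrepancy E g \<le> k"
        by (intro disc splits_pairs_extend[OF g(2)]) auto
    qed
    then show ?thesis using start abV by blast
  qed
qed

section \<open>From labels to signs, and the bound\<close>

text \<open>A product of two signs is 1 exactly when the labels agree, that is when their sum is
  even. The sign -1 also falls on unlabelled points, but all edges lie in \<open>V\<close>, where
  every label is 0 or 1.\<close>

lemma discrepancy_eq_edge_sum:
  assumes "simple_graph V E" "finite E" "\<And>v. v \<in> V \<Longrightarrow> g v \<in> {Some 0, Some 1}"
  shows "discrepancy E g = \<bar>edge_sum E (\<lambda>v. if g v = Some 0 then 1 else -1)\<bar>"
proof -
  let ?s = "\<lambda>v. if g v = Some 0 then 1 else -1 :: int"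
  \<comment> \<open>A difference of two indicators, so that summing over \<open>E\<close> yields the
    two edge counts.\<close>
  have "prod ?s e = int (if edge_label g e = 0 then 1 else 0) - int (if edge_label g e = 1 then 1 else 0)"
    if "e \<in> E" for e
  proof -
    from that obtain a b where ab: "e = {a, b}" "a \<noteq> b" "e \<subseteq> V"
      using assms(1) unfolding simple_graph_def by (metis card_2_iff)
    then show ?thesis
      using assms(3)[of a] assms(3)[of b] by (auto simp: edge_label_def)
  qed
  then have "edge_sum E ?s = (\<Sum>e\<in>E. int (if edge_label g e = 0 then 1 else 0) - int (if edge_label g e = 1 then 1 else 0))"
    by (simp add: edge_sum_def)
  also have "\<dots> = int (\<Sum>e\<in>E. if edge_label g e = 0 then 1 else 0) - int (\<Sum>e\<in>E. if edge_label g e = 1 then 1 else 0)"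
    by (simp only: sum_subtractf of_nat_sum)
  also have "\<dots> = int (num_edges_labelled E g 0) - int (num_edges_labelled E g 1)"
    using assms(2) by (simp add: num_edges_labelled_def sum.If_cases Int_def)
  finally show ?thesis by (simp add: discrepancy_def abs_minus_commute)
qed

theorem theorem3p1:
  fixes V :: "'a set" and E :: "'a set set" and n :: nat
  assumes "tree V E" and "card V = n"
  shows "real_of_int (game_cordiality_number V E) \<le> 1 / 2 * real n"
proof -
  obtain r where T: "rooted_tree r V E" using assms(1) by (rule tree_imp_rooted_tree)
  obtain M where M: "pairing V M"
    and bound: "\<And>s. signing M s \<Longrightarrow> 2 * \<bar>edge_sum E s\<bar> \<le> int (card V)"
    using rooted_tree_pairing[OF T] by blast
  have simple: "simple_graph V E" using assms(1) by (simp add: tree_def)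
  \<comment> \<open>The discrepancy is an integer, so half of \<open>n\<close> may be rounded
    down.\<close>
  have "game_cordiality_number V E \<le> int n div 2"
  proof (rule game_cordiality_number_pairing[OF _ _ M])
    show "finite V" using T by (rule rooted_tree_finite)
    show "V \<noteq> {}" using rooted_tree_root[OF T] by blast
    fix g assume g: "splits_pairs V M g"
    \<comment> \<open>Everything not labelled 0 gets -1, so \<open>?s\<close> is a sign at every
      point of the type, as \<open>signing\<close> demands.\<close>
    let ?s = "\<lambda>v. if g v = Some 0 then 1 else -1 :: int"
    have "prod ?s e = -1" if "e \<in> M" for e
    proof -
      obtain a b where ab: "e = {a, b}" "a \<noteq> b"
        using pairing_elem[OF M \<open>e \<in> M\<close>] .
      have "g ` e = {Some 0, Some 1}" using g that unfolding splits_pairs_def by blast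
      then have "{g a, g b} = {Some 0, Some 1}" using ab(1) by simp
      then show ?thesis using ab by (auto simp: doubleton_eq_iff)
    qed
    then have "signing M ?s" by (auto simp: signing_def)
    moreover have "discrepancy E g = \<bar>edge_sum E ?s\<bar>"
      using g by (intro discrepancy_eq_edge_sum[OF simple rooted_tree_finite_edges[OF T]])
        (auto simp: splits_pairs_def)
    ultimately show "discrepancy E g \<le> int n div 2" using bound[of ?s] assms(2) by simp
  qed
  then show ?thesis by linarith
qed

end
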